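(* For a full binary tree $T$ let $\Lambda_1(T)=\sum_{v\in\operatorname{int}(T)}|\mathcal L(v)|$. Among all full binary trees with $k$ leaves, the minimum and maximum values of $\Lambda_1$ are $$\Lambda_1^{\min}=k\lfloor\log_2k\rfloor+2\{k-2^{\lfloor\log_2k\rfloor}\},\qquad \Lambda_1^{\max}=\frac{k(k+1)}2-1.$$ Nearly complete balanced trees attain the minimum, and the sequential tree attains the maximum. Consequently, every family $T_\bullet=(T_k)_{k\in\mathcal K}$ with a well-defined exponent $\alpha(T_\bullet)$ satisfies $\alpha(T_\bullet)\in[1/2,1]$.
   Context: A full binary tree is one in which every internal node has exactly two children. $\operatorname{int}(T)$ is the set of internal nodes and $\mathcal L(v)$ the set of leaves below $v$. A nearly complete balanced tree with $k$ leaves is one whose leaves all have depth $\lfloor\log_2k\rfloor$ or $\lfloor\log_2k\rfloor+1$ (depth = number of edges from the root). The sequential tree with $k$ leaves adds the leaves one at a time to a running sum, i.e. every internal node has at least one child that is a leaf. A family $T_\bullet=(T_k)_{k\in\mathcal K}$ consists of an unbounded set $\mathcal K\subseteq\mathbb N$ and, for each $k\in\mathcal K$, one full binary tree $T_k$ with $k$ leaves. Its exponent, well defined when the limit exists, is $$\alpha(T_\bullet)=\frac12\lim_{\substack{k\to\infty\\k\in\mathcal K}}\frac{\log\Lambda_1(T_k)}{\log k}.$$ *)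

theory Defs
  imports Complex_Main "HOL-Library.Tree" "HOL-Library.Sublist"
begin

text \<open>
  Every value of type \<open>unit tree\<close> is a full binary tree: a \<open>Node\<close> has exactly two children and
  a \<open>Leaf\<close> has none. Nodes are identified with their addresses, i.e. the list of turns taken on
  the path from the root (\<open>False\<close> = left, \<open>True\<close> = right). Hence the depth of a node is the length
  of its address, and \<open>w\<close> lies below \<open>v\<close> iff \<open>v\<close> is a prefix of \<open>w\<close>.
\<close>

primrec internal_nodes :: "unit tree \<Rightarrow> bool list set" where
  "internal_nodes Leaf = {}"
| "internal_nodes (Node l u r) =
     insert [] ((#) False ` internal_nodes l \<union> (#) True ` internal_nodes r)"

primrec leaves :: "unit tree \<Rightarrow> bool list set" where
  "leaves Leaf = {[]}"
| "leaves (Node l u r) = (#) False ` leaves l \<union> (#) True ` leaves r"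

definition leaves_below :: "unit tree \<Rightarrow> bool list \<Rightarrow> bool list set" where
  "leaves_below T v = {w \<in> leaves T. prefix v w}"

definition Lambda1 :: "unit tree \<Rightarrow> nat" where
  "Lambda1 T = (\<Sum>v\<in>internal_nodes T. card (leaves_below T v))"

definition full_binary_trees :: "nat \<Rightarrow> unit tree set" where
  "full_binary_trees k = {T. card (leaves T) = k}"

definition Lambda1_min :: "nat \<Rightarrow> nat" where
  "Lambda1_min k = Min (Lambda1 ` full_binary_trees k)"

definition Lambda1_max :: "nat \<Rightarrow> nat" where
  "Lambda1_max k = Max (Lambda1 ` full_binary_trees k)"

definition nearly_complete_balanced :: "unit tree \<Rightarrow> bool" where
  "nearly_complete_balanced T \<longleftrightarrow>
     (\<forall>w\<in>leaves T. int (length w) = \<lfloor>log 2 (card (leaves T))\<rfloor> \<or>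
                   int (length w) = \<lfloor>log 2 (card (leaves T))\<rfloor> + 1)"

definition sequential :: "unit tree \<Rightarrow> bool" where
  "sequential T \<longleftrightarrow>
     (\<forall>v\<in>internal_nodes T. v @ [False] \<in> leaves T \<or> v @ [True] \<in> leaves T)"

text \<open>Only the values of \<open>T\<close> on \<open>K\<close> matter. As every tree has a leaf, \<open>0 \<notin> K\<close> automatically.\<close>

definition tree_family :: "nat set \<Rightarrow> (nat \<Rightarrow> unit tree) \<Rightarrow> bool" where
  "tree_family K T \<longleftrightarrow> \<not> bdd_above K \<and> (\<forall>k\<in>K. T k \<in> full_binary_trees k)"

text \<open>The filter \<open>inf at_top (principal K)\<close> expresses \<open>k \<rightarrow> \<infinity>\<close> with \<open>k \<in> K\<close>. It is nontrivial
  because \<open>K\<close> is unbounded, so the limit below is unique whenever it exists.\<close>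

definition exponent_well_defined :: "nat set \<Rightarrow> (nat \<Rightarrow> unit tree) \<Rightarrow> bool" where
  "exponent_well_defined K T \<longleftrightarrow>
     (\<exists>L::real. ((\<lambda>k. ln (Lambda1 (T k)) / ln k) \<longlongrightarrow> L) (inf at_top (principal K)))"

definition exponent :: "nat set \<Rightarrow> (nat \<Rightarrow> unit tree) \<Rightarrow> real" where
  "exponent K T =
     1 / 2 * Lim (inf at_top (principal K)) (\<lambda>k. ln (Lambda1 (T k)) / ln k)"

text \<open>\<open>Min\<close> and \<open>Max\<close> are only meaningful on finite nonempty sets, which is the case here.\<close>

lemma finite_leaves: "finite (leaves T)"
  by (induction T) auto

lemma card_leaves: "card (leaves T) = size1 T"
proof (induction T)
  case (Node l u r)
  have "(#) False ` leaves l \<inter> (#) True ` leaves r = {}" by auto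
  then show ?case
    using Node by (simp add: card_Un_disjoint finite_leaves card_image)
qed simp

lemma finite_full_binary_trees: "finite (full_binary_trees k)"
proof -
  have "finite {T :: unit tree. size1 T \<le> k}"
  proof (induction k)
    case 0
    show ?case by (simp add: size1_size)
  next
    case (Suc k)
    let ?S = "{T :: unit tree. size1 T \<le> k}"
    have "{T :: unit tree. size1 T \<le> Suc k} \<subseteq>
            insert Leaf ((\<lambda>(l, r). Node l () r) ` (?S \<times> ?S))"
    proof
      fix T :: "unit tree"
      assume T: "T \<in> {T. size1 T \<le> Suc k}"
      show "T \<in> insert Leaf ((\<lambda>(l, r). Node l () r) ` (?S \<times> ?S))"
      proof (cases T)
        case (Node l u r)
        with T have "l \<in> ?S" "r \<in> ?S" by (auto simp: size1_size)
        then show ?thesis using Node by auto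
      qed simp
    qed
    then show ?case by (rule finite_subset) (use Suc in simp)
  qed
  then show ?thesis
    by (rule finite_subset[rotated]) (auto simp: full_binary_trees_def card_leaves)
qed

lemma full_binary_trees_nonempty:
  assumes "k \<ge> 1"
  shows "full_binary_trees k \<noteq> {}"
proof -
  have "\<exists>T :: unit tree. size1 T = k"
    using assms
  proof (induction k rule: dec_induct)
    case base
    show ?case by (rule exI[of _ Leaf]) simp
  next
    case (step n)
    then obtain T :: "unit tree" where "size1 T = n" by blast
    then show ?case by (intro exI[of _ "Node T () Leaf"]) simp
  qed
  then show ?thesis by (auto simp: full_binary_trees_def card_leaves)
qed

end

theory Submission
  imports Defs
begin

text \<open>
  Since \<open>\<Lambda>\<^sub>1(T)\<close> counts the pairs of an internal node and a leaf below it, it is the sum of the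
  depths of the leaves. For integers \<open>j\<close> one has \<open>2\<^bsup>-j\<^esup> \<ge> 1 - j/2\<close> with equality for \<open>j \<in> {0, 1}\<close>.
  Applied to \<open>j = d - m\<close> and summed over the depths \<open>d\<close> of all leaves, this combines with Kraft's
  equality \<open>\<Sum> 2\<^bsup>-d\<^esup> = 1\<close> to \<open>\<Lambda>\<^sub>1(T) \<ge> k m + 2 (k - 2\<^bsup>m\<^esup>)\<close> for every \<open>m\<close>, with equality if all depths
  are \<open>m\<close> or \<open>m + 1\<close>. For the upper bound, splitting \<open>T\<close> at the root into subtrees with \<open>a\<close> and
  \<open>b\<close> leaves leaves the slack \<open>(a - 1) (b - 1)\<close>, which vanishes if one of them is a leaf. The bound
  on the exponent follows from \<open>k \<le> \<Lambda>\<^sub>1(T) \<le> k\<^sup>2\<close>, valid for \<open>k \<ge> 2\<close>.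
\<close>

section \<open>Recursion for \<open>Lambda1\<close> and the total leaf depth\<close>

lemma finite_internal_nodes: "finite (internal_nodes T)"
  by (induction T) auto

lemma sum_leaves_Node:
  "(\<Sum>w\<in>leaves (Node l u r). f w) =
     (\<Sum>w\<in>leaves l. f (False # w)) + (\<Sum>w\<in>leaves r. f (True # w))"
proof -
  have "(#) False ` leaves l \<inter> (#) True ` leaves r = {}" by auto
  then show ?thesis
    by (simp add: sum.union_disjoint finite_leaves sum.reindex)
qed

lemma leaves_below_Nil: "leaves_below T [] = leaves T"
  by (simp add: leaves_below_def)

lemma leaves_below_Node:
  "leaves_below (Node l u r) (b # v) = (#) b ` leaves_below (if b then r else l) v"
  by (auto simp: leaves_below_def)

lemma Lambda1_Leaf: "Lambda1 Leaf = 0"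
  by (simp add: Lambda1_def)

lemma Lambda1_Node:
  "Lambda1 (Node l u r) = size1 l + size1 r + Lambda1 l + Lambda1 r"
proof -
  let ?f = "\<lambda>v. card (leaves_below (Node l u r) v)"
  let ?L = "(#) False ` internal_nodes l" and ?R = "(#) True ` internal_nodes r"
  have "Lambda1 (Node l u r) = ?f [] + (\<Sum>v\<in>?L \<union> ?R. ?f v)"
    unfolding Lambda1_def internal_nodes.simps
    by (rule sum.insert) (auto simp: finite_internal_nodes)
  also have "(\<Sum>v\<in>?L \<union> ?R. ?f v) = (\<Sum>v\<in>?L. ?f v) + (\<Sum>v\<in>?R. ?f v)"
    by (rule sum.union_disjoint) (auto simp: finite_internal_nodes)
  also have "(\<Sum>v\<in>?L. ?f v) = Lambda1 l"
    by (simp add: sum.reindex leaves_below_Node card_image Lambda1_def)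
  also have "(\<Sum>v\<in>?R. ?f v) = Lambda1 r"
    by (simp add: sum.reindex leaves_below_Node card_image Lambda1_def)
  also have "?f [] = size1 l + size1 r"
    by (simp only: leaves_below_Nil card_leaves size1.simps)
  finally show ?thesis by simp
qed

text \<open>Joining two subtrees under a new root deepens every leaf by one, which matches the
  contribution of the root in \<open>Lambda1_Node\<close>.\<close>

lemma Lambda1_eq_sum_depths: "Lambda1 T = (\<Sum>w\<in>leaves T. length w)"
proof (induction T)
  case (Node l u r)
  then show ?case
    unfolding Lambda1_Node sum_leaves_Node
    by (simp add: sum.distrib card_leaves sum_Suc)
qed (simp add: Lambda1_Leaf)

section \<open>Kraft's equality and the sharp lower bound\<close>

lemma kraft_equality: "(\<Sum>w\<in>leaves T. (1 / 2 :: real) ^ length w) = 1"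
proof (induction T)
  case (Node l u r)
  \<comment> \<open>One extra turn halves the weight of each leaf, so either subtree contributes
    1/2.\<close>
  then show ?case
    unfolding sum_leaves_Node by (simp flip: sum_divide_distrib)
qed simp

text \<open>The line is the chord of the convex function 2 powr (m - d) through d = m and d = m + 1.
  Bernoulli's inequality with base 1 + 1 or 1 - 1/2 covers the two signs of m - d.\<close>

lemma half_power_ge: "(1 / 2 :: real) ^ d * 2 ^ m \<ge> 1 - (real d - real m) / 2"
proof (cases "d \<le> m")
  case True
  then obtain j where j: "m = d + j" using le_Suc_ex by blast
  have "(1 / 2 :: real) ^ d * 2 ^ m = (1 + 1) ^ j"
    by (simp add: j power_add power_divide)
  moreover have "(1 + 1) ^ j \<ge> 1 + real j * 1"
    using Bernoulli_inequality[of 1 j] by simp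
  ultimately show ?thesis using j by simp
next
  case False
  then obtain j where j: "d = m + j" by (metis le_Suc_ex nat_le_linear)
  have "(1 / 2 :: real) ^ d * 2 ^ m = (1 + - 1 / 2) ^ j"
    by (simp add: j power_add power_divide)
  moreover have "(1 + - 1 / 2) ^ j \<ge> 1 + real j * (- 1 / 2)"
    using Bernoulli_inequality[of "- 1 / 2" j] by (simp add: mult.commute)
  ultimately show ?thesis using j by simp
qed

text \<open>The chord is affine in the depth, so its sum sees only the number of leaves and their
  total depth.\<close>

lemma sum_tangent_line:
  "(\<Sum>w\<in>leaves T. 1 - (real (length w) - real m) / 2) =
     real (size1 T) - (real (Lambda1 T) - real (size1 T) * real m) / 2"
  by (simp add: sum_subtractf card_leaves Lambda1_eq_sum_depths flip: sum_divide_distrib)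

lemma Lambda1_ge:
  "real (size1 T) * real m + 2 * (real (size1 T) - 2 ^ m) \<le> real (Lambda1 T)"
proof -
  have "(\<Sum>w\<in>leaves T. 1 - (real (length w) - real m) / 2)
          \<le> (\<Sum>w\<in>leaves T. (1 / 2) ^ length w * 2 ^ m)"
    by (intro sum_mono half_power_ge)
  also have "\<dots> = 2 ^ m"
    by (simp only: kraft_equality mult_1 flip: sum_distrib_right)
  finally show ?thesis by (simp only: sum_tangent_line) (simp add: field_simps)
qed

lemma Lambda1_eq_if_balanced:
  assumes "\<And>w. w \<in> leaves T \<Longrightarrow> length w = m \<or> length w = Suc m"
  shows "real (Lambda1 T) = real (size1 T) * real m + 2 * (real (size1 T) - 2 ^ m)"
proof -
  have "(\<Sum>w\<in>leaves T. 1 - (real (length w) - real m) / 2)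
          = (\<Sum>w\<in>leaves T. (1 / 2) ^ length w * 2 ^ m)"
  proof (rule sum.cong)
    show "1 - (real (length w) - real m) / 2 = (1 / 2) ^ length w * 2 ^ m"
      if "w \<in> leaves T" for w
      using assms[OF that] by (auto simp: power_divide)
  qed simp
  also have "\<dots> = 2 ^ m"
    by (simp only: kraft_equality mult_1 flip: sum_distrib_right)
  finally show ?thesis by (simp only: sum_tangent_line) (simp add: field_simps)
qed

text \<open>The closed upper bound \<open>k \<le> 2\<^bsup>m+1\<^esup>\<close> lets the induction halve \<open>k\<close> with rounding up.\<close>

lemma balanced_tree_exists:
  assumes "2 ^ m \<le> k" "k \<le> 2 ^ Suc m"
  shows "\<exists>T :: unit tree. size1 T = k \<and> (\<forall>w\<in>leaves T. length w = m \<or> length w = Suc m)"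
  using assms
proof (induction m arbitrary: k)
  case 0
  then consider "k = 1" | "k = 2" by force
  then show ?case
  proof cases
    case 1
    then show ?thesis by (intro exI[of _ Leaf]) simp
  next
    case 2
    then show ?thesis by (intro exI[of _ "Node Leaf () Leaf"]) simp
  qed
next
  case (Suc m)
  obtain l r :: "unit tree"
    where l: "size1 l = k div 2" "\<forall>w\<in>leaves l. length w = m \<or> length w = Suc m"
      and r: "size1 r = k - k div 2" "\<forall>w\<in>leaves r. length w = m \<or> length w = Suc m"
    using Suc.IH[of "k div 2"] Suc.IH[of "k - k div 2"] Suc.prems by fastforce
  then show ?case by (intro exI[of _ "Node l () r"]) auto
qed

section \<open>Upper bounds and sequential trees\<close>

lemma Lambda1_le: "2 * Lambda1 T + 2 \<le> size1 T * (size1 T + 1)"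
proof (induction T)
  case (Node l u r)
  \<comment> \<open>With \<open>Suc a\<close> and \<open>Suc b\<close> leaves on the two sides, the
    doubled inequality gains slack 2ab over those of the subtrees, without any subtraction on
    naturals.\<close>
  obtain a b where "size1 l = Suc a" "size1 r = Suc b"
    by (metis size1_size add.commute plus_1_eq_Suc)
  with Node show ?case by (simp add: Lambda1_Node algebra_simps)
qed (simp add: Lambda1_Leaf)

lemma Nil_in_leaves_iff: "[] \<in> leaves T \<longleftrightarrow> T = Leaf"
  by (cases T) auto

text \<open>A child of the root is a leaf exactly when its subtree is \<open>Leaf\<close>; at any
  deeper node the condition is that of the subtree, with the first turn dropped.\<close>

lemma sequential_Node:
  "sequential (Node l u r) \<longleftrightarrow> (l = Leaf \<or> r = Leaf) \<and> sequential l \<and> sequential r"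
  by (auto simp: sequential_def ball_Un image_iff Nil_in_leaves_iff)

lemma Lambda1_eq_if_sequential:
  "sequential T \<Longrightarrow> 2 * Lambda1 T + 2 = size1 T * (size1 T + 1)"
proof (induction T)
  case (Node l u r)
  then show ?case
    by (auto simp: sequential_Node Lambda1_Node Lambda1_Leaf algebra_simps)
qed (simp add: Lambda1_Leaf)

lemma sequential_tree_exists:
  assumes "k \<ge> 1"
  shows "\<exists>T. size1 T = k \<and> sequential T"
  using assms
proof (induction k rule: dec_induct)
  case base
  show ?case by (intro exI[of _ Leaf]) (simp add: sequential_def)
next
  case (step n)
  then obtain T where "size1 T = n" "sequential T" by blast
  then show ?case
    by (intro exI[of _ "Node T () Leaf"]) (simp add: sequential_Node, simp add: sequential_def)
qed

lemma size1_le_Lambda1: "T \<noteq> Leaf \<Longrightarrow> size1 T \<le> Lambda1 T"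
  by (cases T) (auto simp: Lambda1_Node)

lemma Lambda1_le_square: "Lambda1 T \<le> size1 T ^ 2"
proof -
  \<comment> \<open>This absorbs the linear term: with n leaves, 2 \<open>Lambda1 T\<close> + 2
    \<le> n^2 + n \<le> 2 n^2.\<close>
  have "size1 T * 1 \<le> size1 T * size1 T"
    by (intro mult_le_mono2) (simp add: size1_size)
  with Lambda1_le[of T] show ?thesis
    unfolding power2_eq_square distrib_left by linarith
qed

section \<open>Extremal values over all trees with \<open>k\<close> leaves\<close>

lemma full_binary_trees_iff: "T \<in> full_binary_trees k \<longleftrightarrow> size1 T = k"
  by (simp add: full_binary_trees_def card_leaves)

lemma Lambda1_min_eqI:
  assumes "T \<in> full_binary_trees k" "\<And>S. S \<in> full_binary_trees k \<Longrightarrow> Lambda1 T \<le> Lambda1 S"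
  shows "Lambda1_min k = Lambda1 T"
  unfolding Lambda1_min_def
  by (rule Min_eqI) (use assms in \<open>auto simp: finite_full_binary_trees\<close>)

lemma Lambda1_max_eqI:
  assumes "T \<in> full_binary_trees k" "\<And>S. S \<in> full_binary_trees k \<Longrightarrow> Lambda1 S \<le> Lambda1 T"
  shows "Lambda1_max k = Lambda1 T"
  unfolding Lambda1_max_def
  by (rule Max_eqI) (use assms in \<open>auto simp: finite_full_binary_trees\<close>)

text \<open>Every competitor obeys \<open>Lambda1_ge\<close> for this same \<open>m\<close>, and
  \<open>T\<close> meets that bound with equality.\<close>

lemma Lambda1_min_attained:
  assumes "T \<in> full_binary_trees k" "\<And>w. w \<in> leaves T \<Longrightarrow> length w = m \<or> length w = Suc m"
  shows "Lambda1_min k = Lambda1 T"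
proof (rule Lambda1_min_eqI)
  fix S assume "S \<in> full_binary_trees k"
  then have "real (Lambda1 T) \<le> real (Lambda1 S)"
    using Lambda1_eq_if_balanced[OF assms(2)] Lambda1_ge[of S m] assms(1)
    by (simp add: full_binary_trees_iff)
  then show "Lambda1 T \<le> Lambda1 S" by simp
qed fact

lemma Lambda1_max_attained:
  assumes "T \<in> full_binary_trees k" "sequential T"
  shows "Lambda1_max k = Lambda1 T"
proof (rule Lambda1_max_eqI)
  fix S assume "S \<in> full_binary_trees k"
  then show "Lambda1 S \<le> Lambda1 T"
    using Lambda1_eq_if_sequential[OF assms(2)] Lambda1_le[of S] assms(1)
    by (simp add: full_binary_trees_iff)
qed fact

section \<open>Logarithms and the exponent\<close>

lemma floor_log2_bounds:
  assumes "k \<ge> 1"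
  obtains m where "\<lfloor>log 2 (real k)\<rfloor> = int m" "2 ^ m \<le> k" "k < 2 ^ Suc m"
proof -
  obtain m where m: "2 ^ m \<le> k" "k < 2 ^ Suc m"
    using ex_power_ivl1[of 2 k] assms by auto
  moreover have "\<lfloor>log 2 (real k)\<rfloor> = int m"
    using m floor_log_nat_eq_powr_iff[of 2 k m] assms by simp
  ultimately show ?thesis using that by blast
qed

lemma nearly_complete_balanced_iff:
  assumes "size1 T = k" "\<lfloor>log 2 (real k)\<rfloor> = int m"
  shows "nearly_complete_balanced T \<longleftrightarrow> (\<forall>w\<in>leaves T. length w = m \<or> length w = Suc m)"
proof -
  have "int n = int m + 1 \<longleftrightarrow> n = Suc m" for n by linarith
  then show ?thesis using assms by (simp add: nearly_complete_balanced_def card_leaves)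
qed

text \<open>Taking \<open>k \<ge> 2\<close> rules out \<open>Leaf\<close>, where
  \<open>Lambda1\<close> vanishes, and makes \<open>ln k\<close> positive, so logarithms of k \<le>
  \<open>Lambda1 T\<close> \<le> k^2 can be divided by it.\<close>

lemma ln_Lambda1_ratio_bounds:
  assumes "T \<in> full_binary_trees k" "k \<ge> 2"
  shows "ln (real (Lambda1 T)) / ln (real k) \<in> {1..2}"
proof -
  have k: "size1 T = k" using assms(1) by (simp add: full_binary_trees_iff)
  with assms(2) have "T \<noteq> Leaf" by auto
  with k have "k \<le> Lambda1 T" "Lambda1 T \<le> k ^ 2"
    using size1_le_Lambda1[of T] Lambda1_le_square[of T] by simp_all
  then have "real k \<le> real (Lambda1 T)" "real (Lambda1 T) \<le> real k ^ 2"
    by (simp_all flip: of_nat_power)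
  then have "ln (real k) \<le> ln (real (Lambda1 T))" "ln (real (Lambda1 T)) \<le> ln (real k ^ 2)"
    using assms(2) by simp_all
  moreover have "ln (real k ^ 2) = 2 * ln (real k)"
    using assms(2) by (simp add: ln_realpow)
  ultimately show ?thesis using assms(2) by (simp add: field_simps)
qed

text \<open>An unbounded set meets every tail of the naturals; this makes limits along
  \<open>K\<close> unique.\<close>

lemma principal_at_top_neq_bot:
  assumes "\<not> bdd_above (K :: nat set)"
  shows "inf at_top (principal K) \<noteq> bot"
proof
  assume "inf at_top (principal K) = bot"
  then have "\<forall>\<^sub>F k in at_top. k \<notin> K"
    by (simp add: trivial_limit_def eventually_inf_principal)
  then obtain N where "\<forall>n\<ge>N. n \<notin> K" by (auto simp: eventually_at_top_linorder)
  then have "bdd_above K" by (intro bdd_aboveI[of _ N]) (metis nat_le_linear)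
  with assms show False by simp
qed

lemma exponent_bounds:
  assumes "tree_family K T" "exponent_well_defined K T"
  shows "exponent K T \<in> {1 / 2..1}"
proof -
  let ?F = "inf at_top (principal K)"
  let ?q = "\<lambda>k. ln (real (Lambda1 (T k))) / ln (real k)"
  have nt: "?F \<noteq> bot"
    using assms(1) by (simp add: tree_family_def principal_at_top_neq_bot)
  obtain L where L: "(?q \<longlongrightarrow> L) ?F"
    using assms(2) by (auto simp: exponent_well_defined_def)
  have "\<forall>\<^sub>F k in ?F. ?q k \<in> {1..2}"
    unfolding eventually_inf_principal using eventually_ge_at_top[of 2]
  proof eventually_elim
    case (elim k)
    then show ?case
      using assms(1) by (intro impI ln_Lambda1_ratio_bounds) (simp_all add: tree_family_def)
  qed
  \<comment> \<open>The interval is closed, so the limit inherits the eventual bounds on the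
    ratios.\<close>
  then have "L \<in> {1..2}"
    by (intro Lim_in_closed_set[OF _ _ nt L]) auto
  moreover have "Lim ?F ?q = L"
    using tendsto_Lim[OF nt L] .
  ultimately show ?thesis by (simp add: exponent_def)
qed

theorem proposition3p1:
  shows
    "(\<forall>k::nat. k \<ge> 1 \<longrightarrow>
        real (Lambda1_min k) =
          real k * real_of_int \<lfloor>log 2 (real k)\<rfloor> + 2 * (real k - 2 powi \<lfloor>log 2 (real k)\<rfloor>) \<and>
        real (Lambda1_max k) = real k * (real k + 1) / 2 - 1 \<and>
        (\<exists>T\<in>full_binary_trees k. nearly_complete_balanced T) \<and>
        (\<forall>T\<in>full_binary_trees k. nearly_complete_balanced T \<longrightarrow> Lambda1 T = Lambda1_min k) \<and>
        (\<exists>T\<in>full_binary_trees k. sequential T) \<and>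
        (\<forall>T\<in>full_binary_trees k. sequential T \<longrightarrow> Lambda1 T = Lambda1_max k)) \<and>
     (\<forall>K T. tree_family K T \<longrightarrow> exponent_well_defined K T \<longrightarrow>
        exponent K T \<in> {1 / 2..1})"
proof (rule conjI; intro allI impI)
  fix k :: nat assume k: "k \<ge> 1"
  show "real (Lambda1_min k) =
          real k * real_of_int \<lfloor>log 2 (real k)\<rfloor> + 2 * (real k - 2 powi \<lfloor>log 2 (real k)\<rfloor>) \<and>
        real (Lambda1_max k) = real k * (real k + 1) / 2 - 1 \<and>
        (\<exists>T\<in>full_binary_trees k. nearly_complete_balanced T) \<and>
        (\<forall>T\<in>full_binary_trees k. nearly_complete_balanced T \<longrightarrow> Lambda1 T = Lambda1_min k) \<and>
        (\<exists>T\<in>full_binary_trees k. sequential T) \<and>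
        (\<forall>T\<in>full_binary_trees k. sequential T \<longrightarrow> Lambda1 T = Lambda1_max k)"
  proof -
    obtain m where m: "\<lfloor>log 2 (real k)\<rfloor> = int m" "2 ^ m \<le> k" "k < 2 ^ Suc m"
      using floor_log2_bounds[OF k] .
    \<comment> \<open>The strict bound \<open>k < 2 ^ Suc m\<close> is weakened to the closed one of
      \<open>balanced_tree_exists\<close>.\<close>
    obtain B :: "unit tree" where B: "size1 B = k"
      and B': "\<forall>w\<in>leaves B. length w = m \<or> length w = Suc m"
      using balanced_tree_exists m by (metis less_imp_le)
    obtain S where S: "size1 S = k" "sequential S"
      using sequential_tree_exists[OF k] by blast
    have "real (Lambda1_min k) = real k * real m + 2 * (real k - 2 ^ m)"
      using Lambda1_min_attained[of B k m] Lambda1_eq_if_balanced[of B m] B B'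
      by (simp add: full_binary_trees_iff)
    moreover have "real (Lambda1_max k) = real k * (real k + 1) / 2 - 1"
    proof -
      have "2 * Lambda1_max k + 2 = k * (k + 1)"
        using Lambda1_max_attained[of S k] Lambda1_eq_if_sequential[of S] S
        by (simp add: full_binary_trees_iff)
      then have "2 * real (Lambda1_max k) + 2 = real k * (real k + 1)"
        by (metis of_nat_add of_nat_mult of_nat_numeral of_nat_1)
      then show ?thesis by simp
    qed
    moreover have "nearly_complete_balanced B"
      using nearly_complete_balanced_iff[OF B m(1)] B' by simp
    moreover have "Lambda1 T = Lambda1_min k"
      if "T \<in> full_binary_trees k" "nearly_complete_balanced T" for T
      using that nearly_complete_balanced_iff[OF _ m(1)] Lambda1_min_attained[of T k m]
      by (simp add: full_binary_trees_iff)
    moreover have "Lambda1 T = Lambda1_max k"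
      if "T \<in> full_binary_trees k" "sequential T" for T
      using that Lambda1_max_attained by simp
    moreover have "B \<in> full_binary_trees k" "S \<in> full_binary_trees k"
      using B S by (simp_all add: full_binary_trees_iff)
    \<comment> \<open>The floor is \<open>int m\<close>, so \<open>2 powi int m\<close> turns into
      the natural power \<open>2 ^ m\<close>.\<close>
    ultimately show ?thesis
      using S(2) by (auto simp only: m(1) power_int_of_nat of_int_of_nat_eq)
  qed
qed (rule exponent_bounds)

end
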